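(* Every tribe with stable path objects $(\mathsf{C}, \mathcal{A})$ admits a weak factorization system $(\mathcal{L}, \mathcal{R})$, where $\mathcal{L}$ is the class of arrows having the left lifting property with respect to every arrow in $\mathcal{A}$, and $\mathcal{R}$ is the class of arrows having the right lifting property with respect to every arrow in $\mathcal{L}$.
   Context: An arrow $f$ has the left lifting property (l.l.p.) with respect to $g$ (equivalently $g$ has the right lifting property (r.l.p.) with respect to $f$) if every commutative square with $f$ on the left and $g$ on the right admits a diagonal filler making both triangles commute. A weak factorization system on $\mathsf{C}$ is a pair of classes $(\mathcal{L},\mathcal{R})$ such that every arrow factors as $p\,i$ with $i\in\mathcal{L}$, $p\in\mathcal{R}$, and $\mathcal{R}$ is exactly the class of arrows with the r.l.p. with respect to all arrows of $\mathcal{L}$, while $\mathcal{L}$ is exactly the class of arrows with the l.l.p. with respect to all arrows of $\mathcal{R}$. A tribe is a pair $(\mathsf{C},\mathcal{A})$ where $\mathsf{C}$ has a terminal object $\mathbf{1}$ and $\mathcal{A}$ is a class of arrows such that: (a) for every pair of arrows with the same codomain, at least one of which is in $\mathcal{A}$, there is a chosen pullback square; (b) $\mathcal{A}$ is closed under composition and base change; (c) all isomorphisms and all arrows into $\mathbf{1}$ are in $\mathcal{A}$. The tribe has path objects if for every $p\colon E\to Y$ in $\mathcal{A}$ there is a chosen factorization of the diagonal $\Delta_p=\langle \mathrm{id}_E,\mathrm{id}_E\rangle\colon E\to E\times_p E$ as $\mathrm{r}_p\colon E\to \mathrm{Path}(p)$ followed by $\partial_p\colon \mathrm{Path}(p)\to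 E\times_p E$, such that $\partial_p\in\mathcal{A}$ and every base change of $\mathrm{r}_p$ along an arrow of $\mathcal{A}$ has the l.l.p. with respect to every arrow of $\mathcal{A}$. Write $\partial^0_p,\partial^1_p$ for the two components of $\partial_p$. For $g\colon X\to E$ and $p\colon E\to Y$ in $\mathcal{A}$, the mapping path object $\mathrm{Map}_p(g)$ is the pullback of $g$ along $\partial^0_p$, with projections $\mathrm{pm}_0\colon \mathrm{Map}_p(g)\to X$ and $\mathrm{pm}_1\colon \mathrm{Map}_p(g)\to \mathrm{Path}(p)$. The tribe with path objects has stable path objects if for every $p\colon E\to Y$ in $\mathcal{A}$ and every $f\colon X\to Y$, letting $F$ be the pullback of $f$ and $p$ with base-change arrows $f^*p\colon F\to X$ (in $\mathcal{A}$) and $p^*f\colon F\to E$, there exists an arrow $i\colon \mathrm{Map}_p(p^*f)\to \mathrm{Path}(f^*p)$ with $i\circ\langle \mathrm{id}_F,\mathrm{r}_p\, p^*f\rangle=\mathrm{r}_{f^*p}$ and $\partial_{f^*p}\circ i=\langle \mathrm{pm}_0,\langle (f^*p)\,\mathrm{pm}_0,\ \partial^1_p\,\mathrm{pm}_1\rangle\rangle\colon \mathrm{Map}_p(p^*f)\to F\times_{f^*p}F$. *)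

theory Defs
  imports Main
begin

section \<open>Categories, lifting properties, weak factorization systems\<close>

text \<open>Composition is in applicative order: \<open>g \<cdot>\<^bsub>C\<^esub> f\<close> is ``\<open>f\<close>, then \<open>g\<close>''.
  Nothing is assumed about its value on non-composable arrows, nor about any operation outside the
  carriers \<open>Obj\<close> and \<open>Arr\<close>.\<close>

record ('o, 'a) category =
  Obj :: "'o set"
  Arr :: "'a set"
  Dom :: "'a \<Rightarrow> 'o"
  Cod :: "'a \<Rightarrow> 'o"
  Ide :: "'o \<Rightarrow> 'a"
  Comp :: "'a \<Rightarrow> 'a \<Rightarrow> 'a"  (infixl "\<cdot>\<index>" 70)

definition Hom :: "('o, 'a, 'm) category_scheme \<Rightarrow> 'o \<Rightarrow> 'o \<Rightarrow> 'a set" where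
  "Hom C X Y = {f \<in> Arr C. Dom C f = X \<and> Cod C f = Y}"

locale category =
  fixes C :: "('o, 'a, 'm) category_scheme" (structure)
  assumes Dom_in: "f \<in> Arr C \<Longrightarrow> Dom C f \<in> Obj C"
    and Cod_in: "f \<in> Arr C \<Longrightarrow> Cod C f \<in> Obj C"
    and Ide_in: "X \<in> Obj C \<Longrightarrow> Ide C X \<in> Hom C X X"
    and Comp_in: "\<lbrakk>f \<in> Hom C X Y; g \<in> Hom C Y Z\<rbrakk> \<Longrightarrow> g \<cdot> f \<in> Hom C X Z"
    and Comp_Ide: "f \<in> Arr C \<Longrightarrow> f \<cdot> Ide C (Dom C f) = f"
    and Ide_Comp: "f \<in> Arr C \<Longrightarrow> Ide C (Cod C f) \<cdot> f = f"
    and Comp_assoc: "\<lbrakk>f \<in> Hom C W X; g \<in> Hom C X Y; h \<in> Hom C Y Z\<rbrakk>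
          \<Longrightarrow> (h \<cdot> g) \<cdot> f = h \<cdot> (g \<cdot> f)"

definition is_iso :: "('o, 'a, 'm) category_scheme \<Rightarrow> 'a \<Rightarrow> bool" where
  "is_iso C f \<longleftrightarrow> f \<in> Arr C \<and>
     (\<exists>g \<in> Hom C (Cod C f) (Dom C f).
        g \<cdot>\<^bsub>C\<^esub> f = Ide C (Dom C f) \<and> f \<cdot>\<^bsub>C\<^esub> g = Ide C (Cod C f))"

definition is_terminal :: "('o, 'a, 'm) category_scheme \<Rightarrow> 'o \<Rightarrow> bool" where
  "is_terminal C T \<longleftrightarrow> T \<in> Obj C \<and> (\<forall>X \<in> Obj C. \<exists>!h. h \<in> Hom C X T)"

text \<open>\<open>is_pullback C f g p q\<close>: the square \<open>f \<cdot> p = g \<cdot> q\<close> is a pullback, with \<open>p\<close> opposite to \<open>g\<close>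
  (so \<open>p\<close> is the base change of \<open>g\<close> along \<open>f\<close>) and \<open>q\<close> opposite to \<open>f\<close>.\<close>

definition is_pullback :: "('o, 'a, 'm) category_scheme \<Rightarrow> 'a \<Rightarrow> 'a \<Rightarrow> 'a \<Rightarrow> 'a \<Rightarrow> bool" where
  "is_pullback C f g p q \<longleftrightarrow>
     f \<in> Arr C \<and> g \<in> Arr C \<and> Cod C f = Cod C g \<and>
     p \<in> Arr C \<and> q \<in> Arr C \<and> Dom C p = Dom C q \<and> Cod C p = Dom C f \<and> Cod C q = Dom C g \<and>
     f \<cdot>\<^bsub>C\<^esub> p = g \<cdot>\<^bsub>C\<^esub> q \<and>
     (\<forall>W. \<forall>a \<in> Hom C W (Dom C f). \<forall>b \<in> Hom C W (Dom C g). f \<cdot>\<^bsub>C\<^esub> a = g \<cdot>\<^bsub>C\<^esub> b \<longrightarrow>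
        (\<exists>!h. h \<in> Hom C W (Dom C p) \<and> p \<cdot>\<^bsub>C\<^esub> h = a \<and> q \<cdot>\<^bsub>C\<^esub> h = b))"

definition has_llp :: "('o, 'a, 'm) category_scheme \<Rightarrow> 'a \<Rightarrow> 'a \<Rightarrow> bool" where
  "has_llp C f g \<longleftrightarrow>
     (\<forall>u \<in> Hom C (Dom C f) (Dom C g). \<forall>v \<in> Hom C (Cod C f) (Cod C g).
        g \<cdot>\<^bsub>C\<^esub> u = v \<cdot>\<^bsub>C\<^esub> f \<longrightarrow>
        (\<exists>d \<in> Hom C (Cod C f) (Dom C g). d \<cdot>\<^bsub>C\<^esub> f = u \<and> g \<cdot>\<^bsub>C\<^esub> d = v))"

definition llp_class :: "('o, 'a, 'm) category_scheme \<Rightarrow> 'a set \<Rightarrow> 'a set" where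
  "llp_class C S = {f \<in> Arr C. \<forall>g \<in> S. has_llp C f g}"

definition rlp_class :: "('o, 'a, 'm) category_scheme \<Rightarrow> 'a set \<Rightarrow> 'a set" where
  "rlp_class C S = {g \<in> Arr C. \<forall>f \<in> S. has_llp C f g}"

definition weak_factorization_system ::
    "('o, 'a, 'm) category_scheme \<Rightarrow> 'a set \<Rightarrow> 'a set \<Rightarrow> bool" where
  "weak_factorization_system C L R \<longleftrightarrow>
     L \<subseteq> Arr C \<and> R \<subseteq> Arr C \<and>
     (\<forall>f \<in> Arr C. \<exists>i \<in> L. \<exists>p \<in> R.
        Dom C i = Dom C f \<and> Cod C i = Dom C p \<and> Cod C p = Cod C f \<and> f = p \<cdot>\<^bsub>C\<^esub> i) \<and>
     R = rlp_class C L \<and> L = llp_class C R"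


section \<open>Tribes\<close>

text \<open>The chosen pullback of \<open>f\<close> and \<open>g\<close> is the span of \<open>Pb1 f g\<close> (into the domain of \<open>f\<close>) and
  \<open>Pb2 f g\<close> (into the domain of \<open>g\<close>); its vertex is their common domain.\<close>

record ('o, 'a) tribe = "('o, 'a) category" +
  Fib :: "'a set"
  One :: 'o
  Pb1 :: "'a \<Rightarrow> 'a \<Rightarrow> 'a"
  Pb2 :: "'a \<Rightarrow> 'a \<Rightarrow> 'a"

definition Pb :: "('o, 'a, 'm) tribe_scheme \<Rightarrow> 'a \<Rightarrow> 'a \<Rightarrow> 'o" where
  "Pb C f g = Dom C (Pb1 C f g)"

locale tribe = category C for C :: "('o, 'a, 'm) tribe_scheme" (structure) +
  assumes terminal_One: "is_terminal C (One C)"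
    and Fib_Arr: "Fib C \<subseteq> Arr C"
    and chosen_pullback: "\<lbrakk>f \<in> Arr C; g \<in> Arr C; Cod C f = Cod C g; f \<in> Fib C \<or> g \<in> Fib C\<rbrakk>
          \<Longrightarrow> is_pullback C f g (Pb1 C f g) (Pb2 C f g)"
    and Fib_Comp: "\<lbrakk>f \<in> Fib C; g \<in> Fib C; Cod C f = Dom C g\<rbrakk> \<Longrightarrow> g \<cdot> f \<in> Fib C"
    and Fib_base_change: "\<lbrakk>g \<in> Fib C; is_pullback C f g p q\<rbrakk> \<Longrightarrow> p \<in> Fib C"
    and Fib_iso: "is_iso C f \<Longrightarrow> f \<in> Fib C"
    and Fib_One: "\<lbrakk>f \<in> Arr C; Cod C f = One C\<rbrakk> \<Longrightarrow> f \<in> Fib C"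

text \<open>\<open>pairing C f g a b\<close> is the arrow \<open>\<langle>a, b\<rangle>\<close> into the chosen pullback of \<open>f\<close> and \<open>g\<close>; it is
  meaningful only when that pullback exists and \<open>f \<cdot> a = g \<cdot> b\<close>.\<close>

definition pairing :: "('o, 'a, 'm) tribe_scheme \<Rightarrow> 'a \<Rightarrow> 'a \<Rightarrow> 'a \<Rightarrow> 'a \<Rightarrow> 'a" where
  "pairing C f g a b =
     (THE h. h \<in> Hom C (Dom C a) (Pb C f g) \<and> Pb1 C f g \<cdot>\<^bsub>C\<^esub> h = a \<and> Pb2 C f g \<cdot>\<^bsub>C\<^esub> h = b)"

definition diag :: "('o, 'a, 'm) tribe_scheme \<Rightarrow> 'a \<Rightarrow> 'a" where
  "diag C p = pairing C p p (Ide C (Dom C p)) (Ide C (Dom C p))"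


section \<open>Path objects\<close>

text \<open>\<open>Refl p\<close> and \<open>Bdry p\<close> are the arrows \<open>r\<^sub>p\<close> and \<open>\<partial>\<^sub>p\<close>.\<close>

record ('o, 'a) path_tribe = "('o, 'a) tribe" +
  Refl :: "'a \<Rightarrow> 'a"
  Bdry :: "'a \<Rightarrow> 'a"

definition Path :: "('o, 'a, 'm) path_tribe_scheme \<Rightarrow> 'a \<Rightarrow> 'o" where
  "Path C p = Dom C (Bdry C p)"

definition Bdry0 :: "('o, 'a, 'm) path_tribe_scheme \<Rightarrow> 'a \<Rightarrow> 'a" where
  "Bdry0 C p = Pb1 C p p \<cdot>\<^bsub>C\<^esub> Bdry C p"

definition Bdry1 :: "('o, 'a, 'm) path_tribe_scheme \<Rightarrow> 'a \<Rightarrow> 'a" where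
  "Bdry1 C p = Pb2 C p p \<cdot>\<^bsub>C\<^esub> Bdry C p"

locale path_tribe = tribe C for C :: "('o, 'a, 'm) path_tribe_scheme" (structure) +
  assumes Refl_in: "p \<in> Fib C \<Longrightarrow> Refl C p \<in> Hom C (Dom C p) (Path C p)"
    and Bdry_in: "p \<in> Fib C \<Longrightarrow> Bdry C p \<in> Hom C (Path C p) (Pb C p p)"
    and Bdry_Refl: "p \<in> Fib C \<Longrightarrow> Bdry C p \<cdot> Refl C p = diag C p"
    and Bdry_Fib: "p \<in> Fib C \<Longrightarrow> Bdry C p \<in> Fib C"
    and Refl_base_change_llp:
      "\<lbrakk>p \<in> Fib C; q \<in> Fib C; is_pullback C q (Refl C p) s t; g \<in> Fib C\<rbrakk> \<Longrightarrow> has_llp C s g"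

definition Map :: "('o, 'a, 'm) path_tribe_scheme \<Rightarrow> 'a \<Rightarrow> 'a \<Rightarrow> 'o" where
  "Map C p g = Pb C g (Bdry0 C p)"

definition pm0 :: "('o, 'a, 'm) path_tribe_scheme \<Rightarrow> 'a \<Rightarrow> 'a \<Rightarrow> 'a" where
  "pm0 C p g = Pb1 C g (Bdry0 C p)"

definition pm1 :: "('o, 'a, 'm) path_tribe_scheme \<Rightarrow> 'a \<Rightarrow> 'a \<Rightarrow> 'a" where
  "pm1 C p g = Pb2 C g (Bdry0 C p)"

text \<open>Below, \<open>p' = Pb1 C f p\<close> is \<open>f\<^sup>*p\<close> and \<open>f' = Pb2 C f p\<close> is \<open>p\<^sup>*f\<close>.\<close>

locale stable_path_tribe = path_tribe C for C :: "('o, 'a, 'm) path_tribe_scheme" (structure) +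
  assumes stable: "\<lbrakk>p \<in> Fib C; f \<in> Arr C; Cod C f = Cod C p; p' = Pb1 C f p; f' = Pb2 C f p\<rbrakk>
      \<Longrightarrow> \<exists>i \<in> Hom C (Map C p f') (Path C p').
            i \<cdot> pairing C f' (Bdry0 C p) (Ide C (Pb C f p)) (Refl C p \<cdot> f') = Refl C p' \<and>
            Bdry C p' \<cdot> i =
              pairing C p' p' (pm0 C p f')
                (pairing C f p (p' \<cdot> pm0 C p f') (Bdry1 C p \<cdot> pm1 C p f'))"

end

theory Submission
  imports Defs
begin

text \<open>Factor \<open>f: X \<rightarrow> Y\<close> through its mapping path object \<open>M\<close> as \<open>j: X \<rightarrow> M\<close> followed by a fibration
  \<open>M \<rightarrow> Y\<close>. Lifting against \<open>r\<close> gives a connection on \<open>Path Y\<close>, that is, a fibrewise homotopy contracting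
  the fibration \<open>\<partial>\<^sup>0: Path Y \<rightarrow> Y\<close> to its section \<open>r\<close>. Stability of path objects pulls this homotopy
  back along \<open>f\<close>, which makes \<open>j\<close> the inclusion of a strong deformation retract of \<open>M\<close> over \<open>X\<close>,
  and such inclusions lift against fibrations.\<close>

section \<open>Pullback squares and their uniqueness principle\<close>

context category
begin

lemma Hom_ArrI: "f \<in> Arr C \<Longrightarrow> f \<in> Hom C (Dom C f) (Cod C f)"
  by (simp add: Hom_def)

lemma Hom_Obj:
  assumes "f \<in> Hom C X Y"
  shows "X \<in> Obj C" "Y \<in> Obj C"
  using assms Dom_in Cod_in by (auto simp: Hom_def)

lemma Comp_Ide_Hom: "f \<in> Hom C X Y \<Longrightarrow> f \<cdot> Ide C X = f"
  using Comp_Ide by (auto simp: Hom_def)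

lemma Ide_Comp_Hom: "f \<in> Hom C X Y \<Longrightarrow> Ide C Y \<cdot> f = f"
  using Ide_Comp by (auto simp: Hom_def)

lemma is_iso_Ide:
  assumes "X \<in> Obj C"
  shows "is_iso C (Ide C X)"
proof -
  have "Ide C X \<cdot> Ide C X = Ide C X"
    using Comp_Ide_Hom[OF Ide_in[OF assms]] .
  then show ?thesis
    using assms Ide_in[OF assms] by (auto simp: is_iso_def Hom_def)
qed

lemma is_pullbackI:
  assumes "f \<in> Hom C X Z" "g \<in> Hom C Y Z" "p \<in> Hom C P X" "q \<in> Hom C P Y" "f \<cdot> p = g \<cdot> q"
    and "\<And>W a b. \<lbrakk>a \<in> Hom C W X; b \<in> Hom C W Y; f \<cdot> a = g \<cdot> b\<rbrakk>
      \<Longrightarrow> \<exists>!h. h \<in> Hom C W P \<and> p \<cdot> h = a \<and> q \<cdot> h = b"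
  shows "is_pullback C f g p q"
  using assms by (auto simp: is_pullback_def Hom_def)

lemma is_pullback_lift:
  assumes "is_pullback C f g p q" "a \<in> Hom C W (Dom C f)" "b \<in> Hom C W (Dom C g)" "f \<cdot> a = g \<cdot> b"
  obtains h where "h \<in> Hom C W (Dom C p)" "p \<cdot> h = a" "q \<cdot> h = b"
  using assms unfolding is_pullback_def by meson

lemma is_pullback_eqI:
  assumes pb: "is_pullback C f g p q" and h: "h \<in> Hom C W (Dom C p)" and k: "k \<in> Hom C W (Dom C p)"
    and "p \<cdot> h = p \<cdot> k" "q \<cdot> h = q \<cdot> k"
  shows "h = k"
proof -
  have *: "f \<in> Arr C" "g \<in> Arr C" "p \<in> Arr C" "q \<in> Arr C" "Cod C f = Cod C g" "Dom C p = Dom C q"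
      "Cod C p = Dom C f" "Cod C q = Dom C g" "f \<cdot> p = g \<cdot> q"
    using pb by (auto simp: is_pullback_def)
  have ph: "p \<in> Hom C (Dom C p) (Dom C f)" and qh: "q \<in> Hom C (Dom C p) (Dom C g)"
    and fh: "f \<in> Hom C (Dom C f) (Cod C f)" and gh: "g \<in> Hom C (Dom C g) (Cod C f)"
    using * by (auto simp: Hom_def)
  have "f \<cdot> (p \<cdot> k) = g \<cdot> (q \<cdot> k)"
    using *(9) Comp_assoc[OF k ph fh] Comp_assoc[OF k qh gh] by simp
  moreover have "p \<cdot> k \<in> Hom C W (Dom C f)" "q \<cdot> k \<in> Hom C W (Dom C g)"
    using Comp_in[OF k ph] Comp_in[OF k qh] .
  ultimately have "\<exists>!l. l \<in> Hom C W (Dom C p) \<and> p \<cdot> l = p \<cdot> k \<and> q \<cdot> l = q \<cdot> k"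
    using pb unfolding is_pullback_def by blast
  then show ?thesis using assms by blast
qed

text \<open>The lifting axiom for \<open>Refl\<close> speaks of base changes along fibrations; this
  square lets it be applied to \<open>Refl\<close> itself, since identities are fibrations.\<close>

lemma is_pullback_Ide:
  assumes r: "r \<in> Hom C X Y"
  shows "is_pullback C (Ide C Y) r r (Ide C X)"
proof (rule is_pullbackI)
  note obj = Hom_Obj[OF r]
  show "Ide C Y \<in> Hom C Y Y" "Ide C X \<in> Hom C X X" "r \<in> Hom C X Y" "r \<in> Hom C X Y"
    using r obj Ide_in by auto
  show "Ide C Y \<cdot> r = r \<cdot> Ide C X"
    using Comp_Ide_Hom[OF r] Ide_Comp_Hom[OF r] by simp
  show "\<exists>!h. h \<in> Hom C W X \<and> r \<cdot> h = a \<and> Ide C X \<cdot> h = b"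
    if "a \<in> Hom C W Y" "b \<in> Hom C W X" "Ide C Y \<cdot> a = r \<cdot> b" for W a b
    using that Ide_Comp_Hom by metis
qed

end

section \<open>Arrows into chosen pullbacks\<close>

context tribe
begin

lemma Fib_Ide: "X \<in> Obj C \<Longrightarrow> Ide C X \<in> Fib C"
  using Fib_iso is_iso_Ide by blast

lemma Pb_in:
  assumes "f \<in> Hom C X Z" "g \<in> Hom C Y Z" "f \<in> Fib C \<or> g \<in> Fib C"
  shows "is_pullback C f g (Pb1 C f g) (Pb2 C f g)"
    "Pb1 C f g \<in> Hom C (Pb C f g) X" "Pb2 C f g \<in> Hom C (Pb C f g) Y"
    "f \<cdot> Pb1 C f g = g \<cdot> Pb2 C f g"
    "g \<in> Fib C \<Longrightarrow> Pb1 C f g \<in> Fib C"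
proof -
  show pb: "is_pullback C f g (Pb1 C f g) (Pb2 C f g)"
    using assms chosen_pullback by (auto simp: Hom_def)
  then show "Pb1 C f g \<in> Hom C (Pb C f g) X" "Pb2 C f g \<in> Hom C (Pb C f g) Y"
      "f \<cdot> Pb1 C f g = g \<cdot> Pb2 C f g"
    using assms by (auto simp: is_pullback_def Hom_def Pb_def)
  show "g \<in> Fib C \<Longrightarrow> Pb1 C f g \<in> Fib C"
    using Fib_base_change pb by blast
qed

lemma Pb_eqI:
  assumes "f \<in> Hom C X Z" "g \<in> Hom C Y Z" "f \<in> Fib C \<or> g \<in> Fib C"
    and "h \<in> Hom C W (Pb C f g)" "k \<in> Hom C W (Pb C f g)"
    and "Pb1 C f g \<cdot> h = Pb1 C f g \<cdot> k" "Pb2 C f g \<cdot> h = Pb2 C f g \<cdot> k"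
  shows "h = k"
  using is_pullback_eqI[OF Pb_in(1)[OF assms(1-3)]] assms(4-) by (auto simp: Pb_def)

text \<open>The universal property makes the definite description in \<open>pairing\<close> denote,
  so that such an arrow can be handled through its two components.\<close>

lemma pairing_in:
  assumes fg: "f \<in> Hom C X Z" "g \<in> Hom C Y Z" "f \<in> Fib C \<or> g \<in> Fib C"
    and ab: "a \<in> Hom C W X" "b \<in> Hom C W Y" "f \<cdot> a = g \<cdot> b"
  shows "pairing C f g a b \<in> Hom C W (Pb C f g)"
    "Pb1 C f g \<cdot> pairing C f g a b = a" "Pb2 C f g \<cdot> pairing C f g a b = b"
proof -
  have W: "Dom C a = W" using ab by (simp add: Hom_def)
  obtain h where h: "h \<in> Hom C W (Pb C f g)" "Pb1 C f g \<cdot> h = a" "Pb2 C f g \<cdot> h = b"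
  proof (rule is_pullback_lift[OF Pb_in(1)[OF fg], of a W b])
    show "a \<in> Hom C W (Dom C f)" "b \<in> Hom C W (Dom C g)" "f \<cdot> a = g \<cdot> b"
      using fg ab by (auto simp: Hom_def)
  qed (auto simp: Pb_def)
  have "pairing C f g a b = h"
    unfolding pairing_def W
    by (rule the_equality) (use h Pb_eqI[OF fg] in auto)
  with h show "pairing C f g a b \<in> Hom C W (Pb C f g)"
      "Pb1 C f g \<cdot> pairing C f g a b = a" "Pb2 C f g \<cdot> pairing C f g a b = b" by auto
qed

lemma Comp_pairing:
  assumes fg: "f \<in> Hom C X Z" "g \<in> Hom C Y Z" "f \<in> Fib C \<or> g \<in> Fib C"
    and ab: "a \<in> Hom C W X" "b \<in> Hom C W Y" "f \<cdot> a = g \<cdot> b" and k: "k \<in> Hom C V W"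
  shows "pairing C f g a b \<cdot> k = pairing C f g (a \<cdot> k) (b \<cdot> k)"
proof -
  note p = pairing_in[OF fg ab] and P = Pb_in[OF fg]
  have eq: "f \<cdot> (a \<cdot> k) = g \<cdot> (b \<cdot> k)"
    using ab(3) Comp_assoc[OF k ab(1) fg(1)] Comp_assoc[OF k ab(2) fg(2)] by simp
  note q = pairing_in[OF fg Comp_in[OF k ab(1)] Comp_in[OF k ab(2)] eq]
  show ?thesis
    using Pb_eqI[OF fg Comp_in[OF k p(1)] q(1)] p q
      Comp_assoc[OF k p(1) P(2)] Comp_assoc[OF k p(1) P(3)] by simp
qed

end

section \<open>Path objects, transport and connections\<close>

context path_tribe
begin

text \<open>The start map is a fibration as the composite of \<open>Bdry C p\<close> with a
  projection that is a base change of \<open>p\<close>; the last two identities are the components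
  of the diagonal.\<close>

lemma Bdry01_in:
  assumes pF: "p \<in> Fib C" and p: "p \<in> Hom C X Y"
  shows "Bdry0 C p \<in> Hom C (Path C p) X" "Bdry1 C p \<in> Hom C (Path C p) X"
    "Bdry0 C p \<in> Fib C"
    "p \<cdot> Bdry0 C p = p \<cdot> Bdry1 C p"
    "Refl C p \<in> Hom C X (Path C p)"
    "Bdry0 C p \<cdot> Refl C p = Ide C X" "Bdry1 C p \<cdot> Refl C p = Ide C X"
proof -
  note P = Pb_in[OF p p disjI1[OF pF]] and B = Bdry_in[OF pF]
  show r: "Refl C p \<in> Hom C X (Path C p)"
    using Refl_in[OF pF] p by (simp add: Hom_def)
  show "Bdry0 C p \<in> Hom C (Path C p) X" "Bdry1 C p \<in> Hom C (Path C p) X"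
    using Comp_in[OF B P(2)] Comp_in[OF B P(3)] by (simp_all add: Bdry0_def Bdry1_def)
  show "Bdry0 C p \<in> Fib C"
    unfolding Bdry0_def using Fib_Comp[OF Bdry_Fib[OF pF] P(5)[OF pF]] B P(2) by (simp add: Hom_def)
  show "p \<cdot> Bdry0 C p = p \<cdot> Bdry1 C p"
    unfolding Bdry0_def Bdry1_def
    using P(4) Comp_assoc[OF B P(2) p] Comp_assoc[OF B P(3) p] by simp
  have I: "Ide C X \<in> Hom C X X" using Hom_Obj[OF p] Ide_in by blast
  have "Dom C p = X" using p by (simp add: Hom_def)
  then have "Pb1 C p p \<cdot> diag C p = Ide C X" "Pb2 C p p \<cdot> diag C p = Ide C X"
    using pairing_in[OF p p disjI1[OF pF] I I] by (auto simp: diag_def)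
  then show "Bdry0 C p \<cdot> Refl C p = Ide C X" "Bdry1 C p \<cdot> Refl C p = Ide C X"
    unfolding Bdry0_def Bdry1_def
    using Bdry_Refl[OF pF] Comp_assoc[OF r B P(2)] Comp_assoc[OF r B P(3)] by simp_all
qed

lemma has_llpE:
  assumes "has_llp C f g" "f \<in> Hom C A B" "g \<in> Hom C E D" "u \<in> Hom C A E" "v \<in> Hom C B D"
    "g \<cdot> u = v \<cdot> f"
  obtains d where "d \<in> Hom C B E" "d \<cdot> f = u" "g \<cdot> d = v"
  using assms unfolding has_llp_def Hom_def by auto

lemma Refl_llp:
  assumes "p \<in> Fib C" "g \<in> Fib C"
  shows "has_llp C (Refl C p) g"
  using Refl_base_change_llp[OF assms(1) _ is_pullback_Ide[OF Refl_in[OF assms(1)]] assms(2)]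
    Fib_Ide Hom_Obj[OF Refl_in[OF assms(1)]] by blast

text \<open>A lifting problem against \<open>g\<close> is solved by transporting the partial solution along \<open>H\<close>;
  the transport is a lift against a base change of \<open>r\<^sub>P\<close> along a fibration.\<close>

lemma strong_deformation_retract_llp:
  assumes PF: "P \<in> Fib C" and P: "P \<in> Hom C M X" and j: "j \<in> Hom C X M" and Pj: "P \<cdot> j = Ide C X"
    and H: "H \<in> Hom C M (Path C P)" and H0: "Bdry0 C P \<cdot> H = j \<cdot> P" and H1: "Bdry1 C P \<cdot> H = Ide C M"
    and Hj: "H \<cdot> j = Refl C P \<cdot> j" and gF: "g \<in> Fib C"
  shows "has_llp C j g"
  unfolding has_llp_def
proof (intro ballI impI)
  fix u v
  assume "u \<in> Hom C (Dom C j) (Dom C g)" "v \<in> Hom C (Cod C j) (Cod C g)" and sq: "g \<cdot> u = v \<cdot> j"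
  moreover define E B where "E = Dom C g" and "B = Cod C g"
  ultimately have u: "u \<in> Hom C X E" and v: "v \<in> Hom C M B" and g: "g \<in> Hom C E B"
    using j gF Fib_Arr by (auto simp: Hom_def)
  note b = Bdry01_in[OF PF P]
  \<comment> \<open>In generalized points: \<open>T0\<close> consists of a path of \<open>P\<close>
    and a point of \<open>E\<close> over the value of \<open>v\<close> at its start;
    \<open>S0\<close> below is the part where the path is constant.\<close>
  define w where "w = v \<cdot> Bdry0 C P"
  have w: "w \<in> Hom C (Path C P) B" unfolding w_def using Comp_in[OF b(1) v] .
  note T = Pb_in[OF w g disjI2[OF gF]]
  define T1 T2 where "T1 = Pb1 C w g" and "T2 = Pb2 C w g"
  define T0 where "T0 = Pb C w g"
  have T1: "T1 \<in> Hom C T0 (Path C P)" "T1 \<in> Fib C" and T2: "T2 \<in> Hom C T0 E"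
    and wT: "w \<cdot> T1 = g \<cdot> T2"
    using T gF by (simp_all add: T1_def T2_def T0_def)
  note S = Pb_in[OF T1(1) b(5) disjI1[OF T1(2)]]
  define S0 s t where "S0 = Pb C T1 (Refl C P)" and "s = Pb1 C T1 (Refl C P)" and "t = Pb2 C T1 (Refl C P)"
  have s: "s \<in> Hom C S0 T0" and t: "t \<in> Hom C S0 M" and st: "T1 \<cdot> s = Refl C P \<cdot> t"
    using S by (simp_all add: S0_def s_def t_def)
  have llp: "has_llp C s g"
    using Refl_base_change_llp[OF PF T1(2) S(1) gF] by (simp add: s_def)
  have vB1: "v \<cdot> Bdry1 C P \<in> Hom C (Path C P) B" using Comp_in[OF b(2) v] .
  \<comment> \<open>The endpoints of a constant path agree, so there the point of \<open>E\<close>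
    may stay where it is.\<close>
  have sqT: "g \<cdot> (T2 \<cdot> s) = ((v \<cdot> Bdry1 C P) \<cdot> T1) \<cdot> s"
  proof -
    have "g \<cdot> (T2 \<cdot> s) = (w \<cdot> T1) \<cdot> s" using Comp_assoc[OF s T2 g] wT by simp
    also have "\<dots> = w \<cdot> (Refl C P \<cdot> t)" using Comp_assoc[OF s T1(1) w] st by simp
    also have "\<dots> = (v \<cdot> (Bdry0 C P \<cdot> Refl C P)) \<cdot> t"
      using Comp_assoc[OF t b(5) w] Comp_assoc[OF b(5) b(1) v] by (simp add: w_def)
    also have "\<dots> = (v \<cdot> (Bdry1 C P \<cdot> Refl C P)) \<cdot> t" using b(6,7) by simp
    also have "\<dots> = (v \<cdot> Bdry1 C P) \<cdot> (T1 \<cdot> s)"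
      using Comp_assoc[OF t b(5) vB1] Comp_assoc[OF b(5) b(2) v] st by simp
    finally show ?thesis using Comp_assoc[OF s T1(1) vB1] by simp
  qed
  \<comment> \<open>\<open>l\<close> is the transport: it moves the point of \<open>E\<close> to one
    over the value of \<open>v\<close> at the end of the path.\<close>
  obtain l where l: "l \<in> Hom C T0 E" "l \<cdot> s = T2 \<cdot> s" "g \<cdot> l = (v \<cdot> Bdry1 C P) \<cdot> T1"
    using has_llpE[OF llp s g Comp_in[OF s T2] Comp_in[OF T1(1) vB1] sqT] .
  have uP: "u \<cdot> P \<in> Hom C M E" using Comp_in[OF P u] .
  have sqk: "w \<cdot> H = g \<cdot> (u \<cdot> P)"
    using Comp_assoc[OF H b(1) v] Comp_assoc[OF P u g] Comp_assoc[OF P j v] H0 sq by (simp add: w_def)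
  \<comment> \<open>A point of \<open>M\<close> is sent to its path under \<open>H\<close>, paired
    with the value of \<open>u\<close> at its retraction to \<open>X\<close>; the pair lies in
    \<open>T0\<close> because \<open>H\<close> starts at \<open>j \<cdot> P\<close>.\<close>
  define k where "k = pairing C w g H (u \<cdot> P)"
  note k = pairing_in[OF w g disjI2[OF gF] H uP sqk, folded k_def T0_def T1_def T2_def]
  have kj: "k \<cdot> j \<in> Hom C X T0" using Comp_in[OF j k(1)] .
  have T1kj: "T1 \<cdot> (k \<cdot> j) = Refl C P \<cdot> j" using Comp_assoc[OF j k(1) T1(1)] k Hj by simp
  \<comment> \<open>On the image of \<open>j\<close> the homotopy is constant, so
    \<open>k \<cdot> j\<close> factors through \<open>s\<close>, where transport does
    nothing.\<close>
  define m where "m = pairing C T1 (Refl C P) (k \<cdot> j) j"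
  note m = pairing_in[OF T1(1) b(5) disjI1[OF T1(2)] kj j T1kj, folded m_def S0_def s_def t_def]
  have "(l \<cdot> k) \<cdot> j = (l \<cdot> s) \<cdot> m"
    using Comp_assoc[OF j k(1) l(1)] Comp_assoc[OF m(1) s l(1)] m by simp
  also have "\<dots> = (T2 \<cdot> k) \<cdot> j"
    using Comp_assoc[OF m(1) s T2] Comp_assoc[OF j k(1) T2] m l by simp
  also have "\<dots> = u" using Comp_assoc[OF j P u] k Pj Comp_Ide_Hom[OF u] by simp
  finally have 1: "(l \<cdot> k) \<cdot> j = u" .
  have 2: "g \<cdot> (l \<cdot> k) = v"
    using Comp_assoc[OF k(1) l(1) g] l k Comp_assoc[OF k(1) T1(1) vB1] Comp_assoc[OF H b(2) v] H1
      Comp_Ide_Hom[OF v] by simp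
  have "l \<cdot> k \<in> Hom C (Cod C j) (Dom C g)"
    using Comp_in[OF k(1) l(1)] j g by (simp add: Hom_def)
  with 1 2 show "\<exists>d \<in> Hom C (Cod C j) (Dom C g). d \<cdot> j = u \<and> g \<cdot> d = v" by blast
qed

text \<open>\<open>Y \<rightarrow> 1\<close> plays the role of \<open>p\<close>; the second endpoint of the mapping path object is the base change
  of \<open>\<partial>\<^sub>p\<close> along \<open>f \<times> Y\<close> followed by the projection \<open>X \<times> Y \<rightarrow> Y\<close>.\<close>

lemma Bdry1_pm1_Fib:
  assumes tF: "t \<in> Fib C" and t: "t \<in> Hom C Y (One C)" and f: "f \<in> Hom C X Y"
  shows "Bdry1 C t \<cdot> pm1 C t f \<in> Fib C"
proof -
  note b = Bdry01_in[OF tF t] and B = Bdry_in[OF tF]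
  note Q = Pb_in[OF t t disjI1[OF tF]]
  note M = Pb_in[OF f b(1) disjI2[OF b(3)], folded Map_def pm0_def pm1_def]
  \<comment> \<open>The product is formed with \<open>Y\<close> first, so that the projection to
    \<open>Y\<close> is \<open>Pb1\<close>, the base change of the fibration
    \<open>x\<close>.\<close>
  define x where "x = t \<cdot> f"
  have x: "x \<in> Hom C X (One C)" unfolding x_def using Comp_in[OF f t] .
  have xF: "x \<in> Fib C" using Fib_One x by (simp add: Hom_def)
  note R = Pb_in[OF t x disjI1[OF tF]]
  have fR: "f \<cdot> Pb2 C t x \<in> Hom C (Pb C t x) Y" using Comp_in[OF R(3) f] .
  have sqk: "t \<cdot> (f \<cdot> Pb2 C t x) = t \<cdot> Pb1 C t x"
    using R(4) Comp_assoc[OF R(3) f t] by (simp add: x_def)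
  \<comment> \<open>On points this is (b, a) |-> (f(a), b); the swap puts the start of a path before
    its end.\<close>
  define k where "k = pairing C t t (f \<cdot> Pb2 C t x) (Pb1 C t x)"
  note k = pairing_in[OF t t disjI1[OF tF] fR R(2) sqk, folded k_def]
  define e where "e = Bdry1 C t \<cdot> pm1 C t f"
  have e: "e \<in> Hom C (Map C t f) Y" unfolding e_def using Comp_in[OF M(3) b(2)] .
  have sqn: "t \<cdot> e = x \<cdot> pm0 C t f"
    using Comp_assoc[OF M(3) b(2) t] Comp_assoc[OF M(3) b(1) t] Comp_assoc[OF M(2) f t] M(4) b(4)
    by (simp add: e_def x_def)
  define n where "n = pairing C t x e (pm0 C t f)"
  note n = pairing_in[OF t x disjI1[OF tF] e M(2) sqn, folded n_def]
  have kB: "k \<cdot> n = Bdry C t \<cdot> pm1 C t f"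
  proof (rule Pb_eqI[OF t t disjI1[OF tF] Comp_in[OF n(1) k(1)] Comp_in[OF M(3) B]])
    show "Pb1 C t t \<cdot> (k \<cdot> n) = Pb1 C t t \<cdot> (Bdry C t \<cdot> pm1 C t f)"
      using Comp_assoc[OF n(1) k(1) Q(2)] Comp_assoc[OF M(3) B Q(2)] k n M(4)
        Comp_assoc[OF n(1) R(3) f] by (simp add: Bdry0_def)
    show "Pb2 C t t \<cdot> (k \<cdot> n) = Pb2 C t t \<cdot> (Bdry C t \<cdot> pm1 C t f)"
      using Comp_assoc[OF n(1) k(1) Q(3)] Comp_assoc[OF M(3) B Q(3)] k n
      by (simp add: Bdry1_def e_def)
  qed
  \<comment> \<open>A path from f(a) to b amounts to a point of the mapping path object that lies
    over a and ends at b, and \<open>n\<close> records the pair (b, a).\<close>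
  have "is_pullback C k (Bdry C t) n (pm1 C t f)"
  proof (rule is_pullbackI[OF k(1) B n(1) M(3) kB])
    fix W a c
    assume a: "a \<in> Hom C W (Pb C t x)" and c: "c \<in> Hom C W (Path C t)" and ac: "k \<cdot> a = Bdry C t \<cdot> c"
    have ac0: "f \<cdot> (Pb2 C t x \<cdot> a) = Bdry0 C t \<cdot> c"
      using ac Comp_assoc[OF a k(1) Q(2)] Comp_assoc[OF c B Q(2)] k Comp_assoc[OF a R(3) f]
      by (simp add: Bdry0_def)
    have ac1: "Pb1 C t x \<cdot> a = Bdry1 C t \<cdot> c"
      using ac Comp_assoc[OF a k(1) Q(3)] Comp_assoc[OF c B Q(3)] k by (simp add: Bdry1_def)
    define h where "h = pairing C f (Bdry0 C t) (Pb2 C t x \<cdot> a) c"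
    note h = pairing_in[OF f b(1) disjI2[OF b(3)] Comp_in[OF a R(3)] c ac0,
        folded h_def Map_def pm0_def pm1_def]
    have "n \<cdot> h = a"
    proof (rule Pb_eqI[OF t x disjI1[OF tF] Comp_in[OF h(1) n(1)] a])
      show "Pb1 C t x \<cdot> (n \<cdot> h) = Pb1 C t x \<cdot> a"
        using Comp_assoc[OF h(1) n(1) R(2)] Comp_assoc[OF h(1) M(3) b(2)] n h ac1
        by (simp add: e_def)
      show "Pb2 C t x \<cdot> (n \<cdot> h) = Pb2 C t x \<cdot> a"
        using Comp_assoc[OF h(1) n(1) R(3)] n h by simp
    qed
    moreover have "h' = h" if h': "h' \<in> Hom C W (Map C t f)" "n \<cdot> h' = a" "pm1 C t f \<cdot> h' = c" for h'
    proof (rule Pb_eqI[OF f b(1) disjI2[OF b(3)], folded Map_def pm0_def pm1_def])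
      show "pm0 C t f \<cdot> h' = pm0 C t f \<cdot> h"
        using Comp_assoc[OF h'(1) n(1) R(3)] n h h' by simp
    qed (use h h' in auto)
    ultimately show "\<exists>!h. h \<in> Hom C W (Map C t f) \<and> n \<cdot> h = a \<and> pm1 C t f \<cdot> h = c"
      using h by blast
  qed
  then have nF: "n \<in> Fib C" using Fib_base_change[OF Bdry_Fib[OF tF]] by blast
  have "Pb1 C t x \<cdot> n \<in> Fib C"
    using Fib_Comp[OF nF R(5)[OF xF]] n(1) R(2) by (simp add: Hom_def)
  then show ?thesis using n by (simp add: e_def)
qed

text \<open>A connection: it contracts the paths with a fixed starting point onto the constant one.\<close>

lemma connection_exists:
  assumes tF: "t \<in> Fib C" and t: "t \<in> Hom C Y Z"
  obtains c where "c \<in> Hom C (Path C t) (Path C (Bdry0 C t))"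
    "c \<cdot> Refl C t = Refl C (Bdry0 C t) \<cdot> Refl C t"
    "Bdry0 C (Bdry0 C t) \<cdot> c = Refl C t \<cdot> Bdry0 C t"
    "Bdry1 C (Bdry0 C t) \<cdot> c = Ide C (Path C t)"
proof -
  note b = Bdry01_in[OF tF t]
  define p where "p = Bdry0 C t"
  have p: "p \<in> Hom C (Path C t) Y" and pF: "p \<in> Fib C" using b by (simp_all add: p_def)
  note d = Bdry01_in[OF pF p] and B = Bdry_in[OF pF] and Q = Pb_in[OF p p disjI1[OF pF]]
  have I: "Ide C (Path C t) \<in> Hom C (Path C t) (Path C t)" using Ide_in Hom_Obj[OF p] by blast
  have rp: "Refl C t \<cdot> p \<in> Hom C (Path C t) (Path C t)" using Comp_in[OF p b(5)] .
  have pr: "p \<cdot> Refl C t = Ide C Y" using b by (simp add: p_def)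
  have sq: "p \<cdot> (Refl C t \<cdot> p) = p \<cdot> Ide C (Path C t)"
    using Comp_assoc[OF p b(5) p] pr Ide_Comp_Hom[OF p] Comp_Ide_Hom[OF p] by simp
  \<comment> \<open>The constant path at the start of a path, paired with the path itself: they lie
    in one fibre of \<open>p\<close> and are the intended ends of the connection.\<close>
  define v where "v = pairing C p p (Refl C t \<cdot> p) (Ide C (Path C t))"
  note v = pairing_in[OF p p disjI1[OF pF] rp I sq, folded v_def]
  note rr = Comp_in[OF b(5) d(5)]
  \<comment> \<open>Both ends coincide on constant paths, so the doubly constant path is a partial
    solution there; lifting \<open>Refl C t\<close> against the fibration \<open>Bdry C p\<close>
    extends it to all paths.\<close>
  have sqv: "Bdry C p \<cdot> (Refl C p \<cdot> Refl C t) = v \<cdot> Refl C t"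
  proof (rule Pb_eqI[OF p p disjI1[OF pF] Comp_in[OF rr B] Comp_in[OF b(5) v(1)]])
    show "Pb1 C p p \<cdot> (Bdry C p \<cdot> (Refl C p \<cdot> Refl C t)) = Pb1 C p p \<cdot> (v \<cdot> Refl C t)"
      using Comp_assoc[OF rr B Q(2)] Comp_assoc[OF b(5) d(5) d(1)] Comp_assoc[OF b(5) v(1) Q(2)]
        Comp_assoc[OF b(5) p b(5)] v d pr Ide_Comp_Hom[OF b(5)] Comp_Ide_Hom[OF b(5)]
      by (simp add: Bdry0_def[of C p])
    show "Pb2 C p p \<cdot> (Bdry C p \<cdot> (Refl C p \<cdot> Refl C t)) = Pb2 C p p \<cdot> (v \<cdot> Refl C t)"
      using Comp_assoc[OF rr B Q(3)] Comp_assoc[OF b(5) d(5) d(2)] Comp_assoc[OF b(5) v(1) Q(3)]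
        v d Ide_Comp_Hom[OF b(5)]
      by (simp add: Bdry1_def[of C p])
  qed
  obtain c where c: "c \<in> Hom C (Path C t) (Path C p)" "c \<cdot> Refl C t = Refl C p \<cdot> Refl C t"
      "Bdry C p \<cdot> c = v"
    using has_llpE[OF Refl_llp[OF tF Bdry_Fib[OF pF]] b(5) B rr v(1) sqv] .
  have "Bdry0 C p \<cdot> c = Refl C t \<cdot> p" "Bdry1 C p \<cdot> c = Ide C (Path C t)"
    using Comp_assoc[OF c(1) B Q(2)] Comp_assoc[OF c(1) B Q(3)] c v
    by (simp_all add: Bdry0_def[of C p] Bdry1_def)
  with c that show ?thesis unfolding p_def by blast
qed

end

section \<open>The factorization through the mapping path object\<close>

context stable_path_tribe
begin

text \<open>The first factor sends a to (a, constant path at f(a)), the second takes the end of the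
  path. Stability is applied to the start map of the path object of \<open>Y\<close>, not to the
  fibration from \<open>Y\<close> to the terminal object.\<close>

lemma llp_Fib_factorization:
  assumes f: "f \<in> Hom C X Y"
  obtains M j q where "j \<in> Hom C X M" "q \<in> Hom C M Y" "q \<in> Fib C" "q \<cdot> j = f"
    "\<And>g. g \<in> Fib C \<Longrightarrow> has_llp C j g"
proof -
  \<comment> \<open>Path objects belong to fibrations; the one of the object \<open>Y\<close> is
    that of its arrow to the terminal object.\<close>
  obtain t where t: "t \<in> Hom C Y (One C)"
    using terminal_One Hom_Obj[OF f] unfolding is_terminal_def by blast
  have tF: "t \<in> Fib C" using t Fib_One by (simp add: Hom_def)
  note b = Bdry01_in[OF tF t]
  define p where "p = Bdry0 C t"
  have p: "p \<in> Hom C (Path C t) Y" and pF: "p \<in> Fib C" using b by (simp_all add: p_def)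
  define M P m where "M = Pb C f p" and "P = Pb1 C f p" and "m = Pb2 C f p"
  note Pm = Pb_in[OF f p disjI2[OF pF], folded M_def P_def m_def]
  have PF: "P \<in> Fib C" using Pm(5) pF by blast
  note d = Bdry01_in[OF pF p] and D = Bdry01_in[OF PF Pm(2)]
  have IX: "Ide C X \<in> Hom C X X" and IM: "Ide C M \<in> Hom C M M"
    using Ide_in Hom_Obj[OF Pm(2)] by auto
  have rf: "Refl C t \<cdot> f \<in> Hom C X (Path C t)" using Comp_in[OF f b(5)] .
  have sqj: "f \<cdot> Ide C X = p \<cdot> (Refl C t \<cdot> f)"
    using Comp_assoc[OF f b(5) p] b Comp_Ide_Hom[OF f] Ide_Comp_Hom[OF f] by (simp add: p_def)
  define j where "j = pairing C f p (Ide C X) (Refl C t \<cdot> f)"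
  note j = pairing_in[OF f p disjI2[OF pF] IX rf sqj, folded M_def P_def m_def j_def]
  obtain c where c: "c \<in> Hom C (Path C t) (Path C p)" "c \<cdot> Refl C t = Refl C p \<cdot> Refl C t"
      "Bdry0 C p \<cdot> c = Refl C t \<cdot> p" "Bdry1 C p \<cdot> c = Ide C (Path C t)"
    using connection_exists[OF tF t] unfolding p_def by blast
  have "f \<in> Arr C" "Cod C f = Cod C p" using f p by (auto simp: Hom_def)
  from stable[OF pF this P_def m_def] obtain i where
    i: "i \<in> Hom C (Map C p m) (Path C P)"
      "i \<cdot> pairing C m (Bdry0 C p) (Ide C M) (Refl C p \<cdot> m) = Refl C P"
      "Bdry C P \<cdot> i = pairing C P P (pm0 C p m)
         (pairing C f p (P \<cdot> pm0 C p m) (Bdry1 C p \<cdot> pm1 C p m))"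
    unfolding M_def by blast
  note N = Pb_in[OF Pm(3) d(1) disjI2[OF d(3)], folded Map_def pm0_def pm1_def]
  \<comment> \<open>\<open>i\<close> turns a point of \<open>M\<close> and a path of
    \<open>p\<close> starting at its image under \<open>m\<close> into a path of \<open>P\<close>.
    That path starts at the given point and ends over the same point of \<open>X\<close>, with the
    end of the given path as its image under \<open>m\<close>.\<close>
  have iB: "Bdry0 C P \<cdot> i = pm0 C p m"
      "Bdry1 C P \<cdot> i = pairing C f p (P \<cdot> pm0 C p m) (Bdry1 C p \<cdot> pm1 C p m)"
    and y: "pairing C f p (P \<cdot> pm0 C p m) (Bdry1 C p \<cdot> pm1 C p m) \<in> Hom C (Map C p m) M"
      "m \<cdot> pairing C f p (P \<cdot> pm0 C p m) (Bdry1 C p \<cdot> pm1 C p m) = Bdry1 C p \<cdot> pm1 C p m"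
      "P \<cdot> pairing C f p (P \<cdot> pm0 C p m) (Bdry1 C p \<cdot> pm1 C p m) = P \<cdot> pm0 C p m"
  proof -
    have sq: "f \<cdot> (P \<cdot> pm0 C p m) = p \<cdot> (Bdry1 C p \<cdot> pm1 C p m)"
      using Comp_assoc[OF N(2) Pm(2) f] Comp_assoc[OF N(2) Pm(3) p] Comp_assoc[OF N(3) d(2) p]
        Comp_assoc[OF N(3) d(1) p] N(4) Pm(4) d(4) by simp
    note y' = pairing_in[OF f p disjI2[OF pF] Comp_in[OF N(2) Pm(2)] Comp_in[OF N(3) d(2)] sq,
        folded M_def P_def m_def]
    then show "pairing C f p (P \<cdot> pm0 C p m) (Bdry1 C p \<cdot> pm1 C p m) \<in> Hom C (Map C p m) M"
      "m \<cdot> pairing C f p (P \<cdot> pm0 C p m) (Bdry1 C p \<cdot> pm1 C p m) = Bdry1 C p \<cdot> pm1 C p m"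
      "P \<cdot> pairing C f p (P \<cdot> pm0 C p m) (Bdry1 C p \<cdot> pm1 C p m) = P \<cdot> pm0 C p m" by auto
    note z = pairing_in[OF Pm(2) Pm(2) disjI1[OF PF] N(2) y'(1) y'(2)[symmetric]]
    note B = Bdry_in[OF PF] and Q = Pb_in[OF Pm(2) Pm(2) disjI1[OF PF]]
    show "Bdry0 C P \<cdot> i = pm0 C p m"
      "Bdry1 C P \<cdot> i = pairing C f p (P \<cdot> pm0 C p m) (Bdry1 C p \<cdot> pm1 C p m)"
      using Comp_assoc[OF i(1) B Q(2)] Comp_assoc[OF i(1) B Q(3)] i(3) z
      by (simp_all add: Bdry0_def[of C P] Bdry1_def[of C P])
  qed
  have jP: "j \<cdot> P \<in> Hom C M M" and cm: "c \<cdot> m \<in> Hom C M (Path C p)"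
    using Comp_in[OF Pm(2) j(1)] Comp_in[OF Pm(3) c(1)] .
  have sqh: "m \<cdot> (j \<cdot> P) = Bdry0 C p \<cdot> (c \<cdot> m)"
    using Comp_assoc[OF Pm(2) j(1) Pm(3)] Comp_assoc[OF Pm(3) c(1) d(1)]
      Comp_assoc[OF Pm(2) f b(5)] Comp_assoc[OF Pm(3) p b(5)] j c Pm(4) by simp
  \<comment> \<open>A point (a, g) of \<open>M\<close>, with g a path from f(a), goes to j(a)
    together with the connection path from the constant path at f(a) to g; \<open>i\<close> then
    yields a path of \<open>P\<close> from j(a) to (a, g).\<close>
  define h where "h = pairing C m (Bdry0 C p) (j \<cdot> P) (c \<cdot> m)"
  note h = pairing_in[OF Pm(3) d(1) disjI2[OF d(3)] jP cm sqh, folded h_def Map_def pm0_def pm1_def]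
  define H where "H = i \<cdot> h"
  have H: "H \<in> Hom C M (Path C P)" unfolding H_def using Comp_in[OF h(1) i(1)] .
  have H0: "Bdry0 C P \<cdot> H = j \<cdot> P"
    using Comp_assoc[OF h(1) i(1) D(1)] iB h by (simp add: H_def)
  have PjP: "P \<cdot> (j \<cdot> P) = P"
    using Comp_assoc[OF Pm(2) j(1) Pm(2)] j Ide_Comp_Hom[OF Pm(2)] by simp
  have H1: "Bdry1 C P \<cdot> H = Ide C M"
  proof -
    have "Bdry1 C P \<cdot> H = pairing C f p (P \<cdot> pm0 C p m) (Bdry1 C p \<cdot> pm1 C p m) \<cdot> h"
      using Comp_assoc[OF h(1) i(1) D(2)] iB by (simp add: H_def)
    also have "\<dots> = Ide C M"
    proof (rule Pb_eqI[OF f p disjI2[OF pF], folded M_def P_def m_def])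
      show "P \<cdot> (pairing C f p (P \<cdot> pm0 C p m) (Bdry1 C p \<cdot> pm1 C p m) \<cdot> h) = P \<cdot> Ide C M"
        using Comp_assoc[OF h(1) y(1) Pm(2)] y Comp_assoc[OF h(1) N(2) Pm(2)] h PjP
          Comp_Ide_Hom[OF Pm(2)] by simp
      show "m \<cdot> (pairing C f p (P \<cdot> pm0 C p m) (Bdry1 C p \<cdot> pm1 C p m) \<cdot> h) = m \<cdot> Ide C M"
        using Comp_assoc[OF h(1) y(1) Pm(3)] y Comp_assoc[OF h(1) N(3) d(2)] h
          Comp_assoc[OF Pm(3) c(1) d(2)] c Ide_Comp_Hom[OF Pm(3)] Comp_Ide_Hom[OF Pm(3)] by simp
    qed (use Comp_in[OF h(1) y(1)] IM in auto)
    finally show ?thesis .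
  qed
  \<comment> \<open>As \<open>c\<close> sends constant paths to doubly constant ones,
    \<open>h\<close> agrees on the image of \<open>j\<close> with the pairing of the identity and
    reflexivity, which \<open>i\<close> carries to \<open>Refl C P\<close>.\<close>
  have Hj: "H \<cdot> j = Refl C P \<cdot> j"
  proof -
    have rm: "Refl C p \<cdot> m \<in> Hom C M (Path C p)" using Comp_in[OF Pm(3) d(5)] .
    have sq: "m \<cdot> Ide C M = Bdry0 C p \<cdot> (Refl C p \<cdot> m)"
      using Comp_assoc[OF Pm(3) d(5) d(1)] d Ide_Comp_Hom[OF Pm(3)] Comp_Ide_Hom[OF Pm(3)] by simp
    note F = Pm(3) d(1) disjI2[OF d(3)]
    have "h \<cdot> j = pairing C m (Bdry0 C p) ((j \<cdot> P) \<cdot> j) ((c \<cdot> m) \<cdot> j)"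
      unfolding h_def using Comp_pairing[OF F jP cm sqh j(1)] .
    also have "(j \<cdot> P) \<cdot> j = Ide C M \<cdot> j"
      using Comp_assoc[OF j(1) Pm(2) j(1)] j Comp_Ide_Hom[OF j(1)] Ide_Comp_Hom[OF j(1)] by simp
    also have "(c \<cdot> m) \<cdot> j = (Refl C p \<cdot> m) \<cdot> j"
      using Comp_assoc[OF j(1) Pm(3) c(1)] Comp_assoc[OF j(1) Pm(3) d(5)] j
        Comp_assoc[OF f b(5) c(1)] Comp_assoc[OF f b(5) d(5)] c by simp
    also have "pairing C m (Bdry0 C p) (Ide C M \<cdot> j) ((Refl C p \<cdot> m) \<cdot> j) =
        pairing C m (Bdry0 C p) (Ide C M) (Refl C p \<cdot> m) \<cdot> j"
      using Comp_pairing[OF F IM rm sq j(1)] by simp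
    finally have "h \<cdot> j = pairing C m (Bdry0 C p) (Ide C M) (Refl C p \<cdot> m) \<cdot> j" .
    then show ?thesis
      using Comp_assoc[OF j(1) h(1) i(1)] i(2)
        Comp_assoc[OF j(1) pairing_in(1)[OF F IM rm sq, folded Map_def] i(1)] by (simp add: H_def)
  qed
  \<comment> \<open>Unfolded, \<open>M\<close> is the mapping path object of \<open>f\<close> for
    \<open>t\<close>, and \<open>m\<close> is its \<open>pm1\<close>.\<close>
  have "Bdry1 C t \<cdot> m \<in> Fib C"
    using Bdry1_pm1_Fib[OF tF t f] by (simp add: pm1_def m_def p_def)
  moreover have "(Bdry1 C t \<cdot> m) \<cdot> j = f"
    using Comp_assoc[OF j(1) Pm(3) b(2)] j Comp_assoc[OF f b(5) b(2)] b Ide_Comp_Hom[OF f] by simp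
  ultimately show ?thesis
    using that[OF j(1) Comp_in[OF Pm(3) b(2)]]
      strong_deformation_retract_llp[OF PF Pm(2) j(1) j(2) H H0 H1 Hj] by blast
qed

end

text \<open>The two lifting conditions are formal: the first holds by definition, the second by the
  Galois connection between left and right lifting classes. Since \<open>Fib C\<close> lies in the
  right class, the factorization with a fibration as second factor suffices.\<close>

theorem theorem2p8:
  fixes C :: "('o, 'a, 'm) path_tribe_scheme"
  assumes "stable_path_tribe C"
  shows "weak_factorization_system C (llp_class C (Fib C)) (rlp_class C (llp_class C (Fib C)))"
proof -
  interpret stable_path_tribe C by fact
  let ?L = "llp_class C (Fib C)"
  have Fib_R: "Fib C \<subseteq> rlp_class C ?L"
    using Fib_Arr by (auto simp: rlp_class_def llp_class_def)
  have "\<exists>i \<in> ?L. \<exists>p \<in> rlp_class C ?L.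
      Dom C i = Dom C f \<and> Cod C i = Dom C p \<and> Cod C p = Cod C f \<and> f = p \<cdot>\<^bsub>C\<^esub> i"
    if f: "f \<in> Arr C" for f
  proof -
    obtain M j q where jq: "j \<in> Hom C (Dom C f) M" "q \<in> Hom C M (Cod C f)" "q \<in> Fib C"
        "q \<cdot>\<^bsub>C\<^esub> j = f" "\<And>g. g \<in> Fib C \<Longrightarrow> has_llp C j g"
      using llp_Fib_factorization[OF Hom_ArrI[OF f]] by blast
    then have "j \<in> ?L" "q \<in> rlp_class C ?L"
      using Fib_R by (auto simp: llp_class_def Hom_def)
    then show ?thesis
      using jq by (intro bexI[of _ j] bexI[of _ q]) (auto simp: Hom_def)
  qed
  moreover have "?L = llp_class C (rlp_class C ?L)"
    using Fib_R by (auto simp: llp_class_def rlp_class_def)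
  moreover have "?L \<subseteq> Arr C" "rlp_class C ?L \<subseteq> Arr C"
    by (simp_all add: llp_class_def rlp_class_def)
  ultimately show ?thesis
    unfolding weak_factorization_system_def by blast
qed

end
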